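(* There exist two finite three-date kernel systems $\mathbb K=\{\mathcal K_{s,u}\}$ and $\widetilde{\mathbb K}=\{\widetilde{\mathcal K}_{s,u}\}$ ($T=3$, $0\le s\le u\le2$) on a common event tree with common discount factor and reward bounds, having identical endpoint pairs $$\mathcal K_{0,u}=\widetilde{\mathcal K}_{0,u},\qquad \mathcal K_{u,u}=\widetilde{\mathcal K}_{u,u}\qquad\forall u,$$ but $$\mathfrak d_0^{\rm RL,SPE}(\mathbb K)>0,\qquad \mathfrak d_0^{\rm RL,SPE}(\widetilde{\mathbb K})=0 .$$ The positive-loss witness in $\mathbb K$ (a reward system and SPE with strictly positive loss) can be taken with a unique pure SPE and strict action gaps. Hence no functional of $\{(\mathcal K_{0,u},\mathcal K_{u,u})\}_u$ alone can equal the unrestricted worst-equilibrium Price of Relearning $\mathfrak d_0^{\rm RL,SPE}$ on the full model class.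
   Context: Finite controlled event tree: dates $t=0,\dots,T$ (decisions at $0,\dots,T-1$), a single root history $h_0$; at each $h_t$ with $t<T$ a finite nonempty action set; after action $a$, an observation $y$ in a finite set $\mathcal Y_{t+1}(h_t,a)$, leading to $(h_t,a,y)$. Discount $\beta\in(0,1]$; reward systems $r=(r_t,g)$ with $|r_t|\le R_t$, $|g|\le G$ for fixed bounds. A kernel system assigns to each $0\le s\le t<T$, $h_t$, $a$ a nonempty compact set $\mathcal K_{s,t}(h_t,a)\subseteq\Delta(\mathcal Y_{t+1}(h_t,a))$ (one-step kernels of evaluator vintage $s$ at date $t$). For a reward system and pure policy $\pi$: $V_{s,T}^\pi=g$, $Q_t^{s,\pi}(h_t,a)=r_t(h_t,a)+\beta\inf_{q\in\mathcal K_{s,t}(h_t,a)}\sum_yq(y)V_{s,t+1}^\pi(h_t,a,y)$, $V_{s,t}^\pi(h_t)=Q_t^{s,\pi}(h_t,\pi_t(h_t))$. $\pi$ is a pure SPE if $\pi_t(h_t)\in\arg\max_aQ_t^{t,\pi}(h_t,a)$ at every history. $P_0^r=\max_\pi V_{0,0}^\pi(h_0)$ is the vintage-$0$ precommitment value. The worst-equilibrium Price of Relearning is $$\mathfrak d_0^{\rm RL,SPE}(\mathbb K)=\sup_r\ \sup_{\pi\ \text{pure SPE for } r}\bigl[P_0^r-V_{0,0}^\pi(h_0)\bigr],$$ over all reward systems satisfying the bounds. *)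

theory Defs
  imports "HOL-Analysis.Analysis"
begin

text \<open>
  A history is the chronological list of the (action, observation) pairs seen so far.
  The root history is the empty list, and the date of a history is its length.
\<close>

type_synonym ('a, 'y) hist = "('a \<times> 'y) list"

record ('a, 'y) event_tree =
  horizon :: nat
  acts :: "('a, 'y) hist \<Rightarrow> 'a set"
  obs :: "('a, 'y) hist \<Rightarrow> 'a \<Rightarrow> 'y set"

inductive_set hists :: "('a, 'y) event_tree \<Rightarrow> ('a, 'y) hist set"
  for E :: "('a, 'y) event_tree" where
  root: "[] \<in> hists E"
| step: "\<lbrakk>h \<in> hists E; length h < horizon E; a \<in> acts E h; y \<in> obs E h a\<rbrakk>
    \<Longrightarrow> h @ [(a, y)] \<in> hists E"

definition decision_hists :: "('a, 'y) event_tree \<Rightarrow> ('a, 'y) hist set" where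
  "decision_hists E = {h \<in> hists E. length h < horizon E}"

text \<open>
  Observation sets are nonempty as soon as the tree carries a kernel system, because the
  kernel sets below are nonempty sets of probability vectors.
\<close>

definition is_event_tree :: "('a, 'y) event_tree \<Rightarrow> bool" where
  "is_event_tree E \<longleftrightarrow> (\<forall>h\<in>decision_hists E.
     finite (acts E h) \<and> acts E h \<noteq> {} \<and> (\<forall>a\<in>acts E h. finite (obs E h a)))"

definition prob_simplex :: "'y set \<Rightarrow> ('y \<Rightarrow> real) set" where
  "prob_simplex Y = {q. (\<forall>y. 0 \<le> q y) \<and> (\<forall>y. y \<notin> Y \<longrightarrow> q y = 0) \<and> (\<Sum>y\<in>Y. q y) = 1}"

text \<open>
  \<open>K s t h a\<close> is the set of one-step kernels of the vintage-\<open>s\<close> evaluator at date \<open>t\<close>.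
  Compactness refers to the product topology on functions, which on the simplex over a finite
  set is the Euclidean topology. Off its domain of definition a kernel system is
  required to be empty, so that equality of the functions \<open>K s t\<close> is equality of the
  mathematical objects.
\<close>

type_synonym ('a, 'y) kernels = "nat \<Rightarrow> nat \<Rightarrow> ('a, 'y) hist \<Rightarrow> 'a \<Rightarrow> ('y \<Rightarrow> real) set"

definition kernel_system :: "('a, 'y) event_tree \<Rightarrow> ('a, 'y) kernels \<Rightarrow> bool" where
  "kernel_system E K \<longleftrightarrow> (\<forall>s t h a.
     if s \<le> t \<and> t < horizon E \<and> h \<in> hists E \<and> length h = t \<and> a \<in> acts E h
     then K s t h a \<noteq> {} \<and> compact (K s t h a) \<and> K s t h a \<subseteq> prob_simplex (obs E h a)
     else K s t h a = {})"

definition endpoint_pairs ::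
  "('a, 'y) kernels \<Rightarrow> nat \<Rightarrow>
     (('a, 'y) hist \<Rightarrow> 'a \<Rightarrow> ('y \<Rightarrow> real) set) \<times> (('a, 'y) hist \<Rightarrow> 'a \<Rightarrow> ('y \<Rightarrow> real) set)" where
  "endpoint_pairs K = (\<lambda>u. (K 0 u, K u u))"

text \<open>
  A reward system is a pair of running rewards \<open>r_t(h_t, a)\<close>, the date being read off the
  history, and a terminal reward \<open>g(h_T)\<close>. Values off the tree are unconstrained and never used.
\<close>

type_synonym ('a, 'y) rewards =
  "(('a, 'y) hist \<Rightarrow> 'a \<Rightarrow> real) \<times> (('a, 'y) hist \<Rightarrow> real)"

definition reward_systems ::
  "('a, 'y) event_tree \<Rightarrow> (nat \<Rightarrow> real) \<Rightarrow> real \<Rightarrow> ('a, 'y) rewards set" where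
  "reward_systems E R G = {(r, g).
     (\<forall>h\<in>decision_hists E. \<forall>a\<in>acts E h. \<bar>r h a\<bar> \<le> R (length h)) \<and>
     (\<forall>h\<in>hists E. length h = horizon E \<longrightarrow> \<bar>g h\<bar> \<le> G)}"

text \<open>
  Pure policies are extensional functions, so that distinct policies differ at some
  decision history and uniqueness of an equilibrium has its usual meaning.
\<close>

definition policies :: "('a, 'y) event_tree \<Rightarrow> (('a, 'y) hist \<Rightarrow> 'a) set" where
  "policies E = (\<Pi>\<^sub>E h\<in>decision_hists E. acts E h)"

function
  V :: "('a, 'y) event_tree \<Rightarrow> real \<Rightarrow> ('a, 'y) kernels \<Rightarrow> ('a, 'y) rewards \<Rightarrow> nat \<Rightarrow>
    (('a, 'y) hist \<Rightarrow> 'a) \<Rightarrow> ('a, 'y) hist \<Rightarrow> real" and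
  Q :: "('a, 'y) event_tree \<Rightarrow> real \<Rightarrow> ('a, 'y) kernels \<Rightarrow> ('a, 'y) rewards \<Rightarrow> nat \<Rightarrow>
    (('a, 'y) hist \<Rightarrow> 'a) \<Rightarrow> ('a, 'y) hist \<Rightarrow> 'a \<Rightarrow> real" where
  "V E \<beta> K rw s \<pi> h =
     (if length h < horizon E then Q E \<beta> K rw s \<pi> h (\<pi> h) else snd rw h)"
| "Q E \<beta> K rw s \<pi> h a =
     fst rw h a
     + \<beta> * (INF q\<in>K s (length h) h a. \<Sum>y\<in>obs E h a. q y * V E \<beta> K rw s \<pi> (h @ [(a, y)]))"
  by pat_completeness auto
termination
  by (relation "Wellfounded.measure (\<lambda>x. case x of
        Inl (E, \<beta>, K, rw, s, \<pi>, h) \<Rightarrow>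
          (if length h < horizon E then 2 * (horizon E - length h) + 1 else 0)
      | Inr (E, \<beta>, K, rw, s, \<pi>, h, a) \<Rightarrow>
          (if length h < horizon E then 2 * (horizon E - length h) else 1))") auto

declare V.simps [simp del] Q.simps [simp del]

definition pure_SPE ::
  "('a, 'y) event_tree \<Rightarrow> real \<Rightarrow> ('a, 'y) kernels \<Rightarrow> ('a, 'y) rewards \<Rightarrow>
     (('a, 'y) hist \<Rightarrow> 'a) set" where
  "pure_SPE E \<beta> K rw = {\<pi> \<in> policies E. \<forall>h\<in>decision_hists E. \<forall>a\<in>acts E h.
     Q E \<beta> K rw (length h) \<pi> h a \<le> Q E \<beta> K rw (length h) \<pi> h (\<pi> h)}"

definition strict_action_gaps ::
  "('a, 'y) event_tree \<Rightarrow> real \<Rightarrow> ('a, 'y) kernels \<Rightarrow> ('a, 'y) rewards \<Rightarrow>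
     (('a, 'y) hist \<Rightarrow> 'a) \<Rightarrow> bool" where
  "strict_action_gaps E \<beta> K rw \<pi> \<longleftrightarrow> (\<forall>h\<in>decision_hists E. \<forall>a\<in>acts E h. a \<noteq> \<pi> h \<longrightarrow>
     Q E \<beta> K rw (length h) \<pi> h a < Q E \<beta> K rw (length h) \<pi> h (\<pi> h))"

definition precommitment_value ::
  "('a, 'y) event_tree \<Rightarrow> real \<Rightarrow> ('a, 'y) kernels \<Rightarrow> ('a, 'y) rewards \<Rightarrow> real" where
  "precommitment_value E \<beta> K rw = Max ((\<lambda>\<pi>. V E \<beta> K rw 0 \<pi> []) ` policies E)"

definition relearning_loss ::
  "('a, 'y) event_tree \<Rightarrow> real \<Rightarrow> ('a, 'y) kernels \<Rightarrow> ('a, 'y) rewards \<Rightarrow>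
     (('a, 'y) hist \<Rightarrow> 'a) \<Rightarrow> real" where
  "relearning_loss E \<beta> K rw \<pi> = precommitment_value E \<beta> K rw - V E \<beta> K rw 0 \<pi> []"

text \<open>
  The suprema are taken in the extended reals, so no boundedness side condition is built in.
\<close>

definition price_of_relearning ::
  "('a, 'y) event_tree \<Rightarrow> real \<Rightarrow> (nat \<Rightarrow> real) \<Rightarrow> real \<Rightarrow> ('a, 'y) kernels \<Rightarrow> ereal" where
  "price_of_relearning E \<beta> R G K =
     (SUP rw\<in>reward_systems E R G. SUP \<pi>\<in>pure_SPE E \<beta> K rw. ereal (relearning_loss E \<beta> K rw \<pi>))"

definition environment :: "('a, 'y) event_tree \<Rightarrow> real \<Rightarrow> (nat \<Rightarrow> real) \<Rightarrow> real \<Rightarrow> bool" where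
  "environment E \<beta> R G \<longleftrightarrow>
     is_event_tree E \<and> 0 < \<beta> \<and> \<beta> \<le> 1 \<and> (\<forall>t<horizon E. 0 \<le> R t) \<and> 0 \<le> G"

end

theory Submission
  imports Defs
begin

text \<open>
  For a horizon of three, the endpoint pairs show every kernel set except \<open>K 1 2\<close>, the forecast
  that the date-1 evaluator makes for the last date. That forecast steers the equilibrium choice
  at date 1, so hiding it hides a possible disagreement between the planners at dates 0 and 1.

  The example isolates this disagreement. The only decision is a bet, at date 1, on the last
  observation, and it pays 1 if the bet is right. All kernel sets are single point masses. In one
  system every evaluator predicts observation 0. In the other the date-1 evaluator alone, and for
  the last date alone, predicts 1; by date 2 the forecast is 0 again, so the endpoint pairs do not
  change. The date-1 player then strictly prefers to bet on 1, whereas the date-0 evaluator, sure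
  of 0, would have committed to the opposite bet: the loss is 1 (\<open>bet_relearning_loss\<close>).

  In the first system all vintages agree, and then no reward system whatsoever produces a loss
  (\<open>price_of_relearning_consistent\<close>). The one-step worst-case expectation is monotone in the
  continuation value, so backward induction shows that a policy without profitable one-shot
  deviations is optimal among all policies. It is essential here that every vintage \<open>s \<le> t\<close> agrees
  with vintage \<open>t\<close> at date \<open>t\<close>; agreement of vintages 0 and \<open>t\<close>, which is all that the endpoint
  pairs can certify, is not enough.
\<close>

section \<open>Histories and policies\<close>

lemma snoc_in_hists_iff:
  "h @ [(a, y)] \<in> hists E \<longleftrightarrow>
     h \<in> hists E \<and> length h < horizon E \<and> a \<in> acts E h \<and> y \<in> obs E h a"
  by (auto intro: hists.step elim: hists.cases)

lemma finite_hists_of_length: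
  assumes "is_event_tree E"
  shows "finite {h \<in> hists E. length h = n}"
proof (induction n)
  case 0
  have "{h \<in> hists E. length h = 0} \<subseteq> {[]}" by auto
  then show ?case by (rule finite_subset) simp
next
  case (Suc n)
  let ?D = "{h \<in> decision_hists E. length h = n}"
  have "finite ?D"
    by (rule finite_subset[OF _ Suc]) (auto simp: decision_hists_def)
  moreover have "finite (acts E h)" "\<And>a. a \<in> acts E h \<Longrightarrow> finite (obs E h a)"
    if "h \<in> ?D" for h
    using assms that by (auto simp: is_event_tree_def)
  ultimately have fin:
    "finite (\<Union>h\<in>?D. \<Union>a\<in>acts E h. (\<lambda>y. h @ [(a, y)]) ` obs E h a)"
    by (intro finite_UN_I finite_imageI) auto
  have "{h \<in> hists E. length h = Suc n} \<subseteq>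
      (\<Union>h\<in>?D. \<Union>a\<in>acts E h. (\<lambda>y. h @ [(a, y)]) ` obs E h a)"
  proof
    fix h assume "h \<in> {h \<in> hists E. length h = Suc n}"
    then have "h \<in> hists E" "length h = Suc n" by auto
    then show "h \<in> (\<Union>h\<in>?D. \<Union>a\<in>acts E h. (\<lambda>y. h @ [(a, y)]) ` obs E h a)"
      by (cases rule: hists.cases) (auto simp: decision_hists_def)
  qed
  then show ?case using fin by (rule finite_subset)
qed

lemma finite_policies:
  assumes "is_event_tree E"
  shows "finite (policies E)"
proof -
  have "decision_hists E = (\<Union>n<horizon E. {h \<in> hists E. length h = n})"
    by (auto simp: decision_hists_def)
  then have "finite (decision_hists E)"
    using finite_hists_of_length[OF assms] by simp
  then show ?thesis
    using assms unfolding policies_def by (intro finite_PiE) (auto simp: is_event_tree_def)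
qed

lemma policies_nonempty:
  assumes "is_event_tree E"
  shows "policies E \<noteq> {}"
  using assms by (auto simp: policies_def PiE_eq_empty_iff is_event_tree_def)

section \<open>Monotonicity of the worst-case expectation\<close>

lemma kernel_systemD:
  assumes "kernel_system E K" "h \<in> decision_hists E" "a \<in> acts E h" "s \<le> length h"
  shows "K s (length h) h a \<noteq> {}" "K s (length h) h a \<subseteq> prob_simplex (obs E h a)"
proof -
  have "K s (length h) h a \<noteq> {} \<and> K s (length h) h a \<subseteq> prob_simplex (obs E h a)"
    using assms(1)[unfolded kernel_system_def, rule_format, of s "length h" h a] assms(2-4)
    by (simp add: decision_hists_def)
  then show "K s (length h) h a \<noteq> {}" "K s (length h) h a \<subseteq> prob_simplex (obs E h a)"
    by auto
qed

lemma bdd_below_expectations: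
  assumes "finite Y"
  shows "bdd_below ((\<lambda>q. \<Sum>y\<in>Y. q y * v y) ` prob_simplex Y)"
proof (rule bdd_belowI2)
  fix q assume q: "q \<in> prob_simplex Y"
  have "- \<bar>v y\<bar> \<le> q y * v y" if "y \<in> Y" for y
  proof -
    have "q y \<le> (\<Sum>y\<in>Y. q y)"
      using q that assms by (intro member_le_sum) (auto simp: prob_simplex_def)
    then have "0 \<le> q y" "q y \<le> 1" using q by (auto simp: prob_simplex_def)
    then have "\<bar>q y * v y\<bar> \<le> \<bar>v y\<bar>" by (simp add: abs_mult mult_left_le_one_le)
    then show ?thesis by linarith
  qed
  then show "(\<Sum>y\<in>Y. - \<bar>v y\<bar>) \<le> (\<Sum>y\<in>Y. q y * v y)" by (rule sum_mono)
qed

lemma Q_mono: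
  assumes tree: "is_event_tree E" and K: "kernel_system E K" and "0 \<le> \<beta>"
    and h: "h \<in> decision_hists E" "a \<in> acts E h" "s \<le> length h"
    and le: "\<And>y. y \<in> obs E h a \<Longrightarrow>
      V E \<beta> K rw s \<pi>' (h @ [(a, y)]) \<le> V E \<beta> K rw s \<pi> (h @ [(a, y)])"
  shows "Q E \<beta> K rw s \<pi>' h a \<le> Q E \<beta> K rw s \<pi> h a"
proof -
  let ?S = "K s (length h) h a"
  note ks = kernel_systemD[OF K h]
  have "finite (obs E h a)" using tree h by (auto simp: is_event_tree_def)
  then have bdd: "bdd_below ((\<lambda>q. \<Sum>y\<in>obs E h a. q y * v y) ` ?S)" for v
    by (rule bdd_below_mono[OF bdd_below_expectations image_mono[OF ks(2)]])
  have "(INF q\<in>?S. \<Sum>y\<in>obs E h a. q y * V E \<beta> K rw s \<pi>' (h @ [(a, y)]))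
      \<le> (INF q\<in>?S. \<Sum>y\<in>obs E h a. q y * V E \<beta> K rw s \<pi> (h @ [(a, y)]))"
  proof (rule cINF_mono[OF ks(1) bdd])
    fix q assume q: "q \<in> ?S"
    then have "(\<Sum>y\<in>obs E h a. q y * V E \<beta> K rw s \<pi>' (h @ [(a, y)]))
        \<le> (\<Sum>y\<in>obs E h a. q y * V E \<beta> K rw s \<pi> (h @ [(a, y)]))"
      using ks(2) le by (intro sum_mono mult_left_mono) (auto simp: prob_simplex_def)
    then show "\<exists>p\<in>?S. (\<Sum>y\<in>obs E h a. p y * V E \<beta> K rw s \<pi>' (h @ [(a, y)]))
        \<le> (\<Sum>y\<in>obs E h a. q y * V E \<beta> K rw s \<pi> (h @ [(a, y)]))"
      using q by blast
  qed
  then show ?thesis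
    using \<open>0 \<le> \<beta>\<close> by (simp add: Q.simps mult_left_mono)
qed

section \<open>Vintage-independent kernel systems\<close>

definition vintage_consistent :: "('a, 'y) event_tree \<Rightarrow> ('a, 'y) kernels \<Rightarrow> bool" where
  "vintage_consistent E K \<longleftrightarrow> (\<forall>t<horizon E. \<forall>s\<le>t. K s t = K t t)"

lemma vintage_consistentD:
  assumes "vintage_consistent E K" "t < horizon E" "s \<le> t" "s' \<le> t"
  shows "K s t = K s' t"
  using assms unfolding vintage_consistent_def by metis

lemma V_vintage_independent:
  assumes "vintage_consistent E K" "s \<le> length h" "s' \<le> length h"
  shows "V E \<beta> K rw s \<pi> h = V E \<beta> K rw s' \<pi> h"
  using assms(2,3)
proof (induction "horizon E - length h" arbitrary: h)
  case 0
  then show ?case by (simp add: V.simps)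
next
  case (Suc n)
  then have "V E \<beta> K rw s \<pi> (h @ [(a, y)]) = V E \<beta> K rw s' \<pi> (h @ [(a, y)])" for a y
    by (intro Suc.hyps) auto
  moreover have "K s (length h) = K s' (length h)"
    using Suc.prems Suc.hyps(2) by (intro vintage_consistentD[OF assms(1)]) auto
  ultimately show ?case by (simp add: V.simps[of _ _ _ _ _ _ h] Q.simps)
qed

lemma Q_vintage_independent:
  assumes "vintage_consistent E K" "length h < horizon E" "s \<le> length h" "s' \<le> length h"
  shows "Q E \<beta> K rw s \<pi> h a = Q E \<beta> K rw s' \<pi> h a"
proof -
  have "V E \<beta> K rw s \<pi> (h @ [(a, y)]) = V E \<beta> K rw s' \<pi> (h @ [(a, y)])" for y
    using assms by (intro V_vintage_independent) auto
  moreover have "K s (length h) = K s' (length h)"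
    by (rule vintage_consistentD[OF assms])
  ultimately show ?thesis by (simp add: Q.simps)
qed

text \<open>
  The one-shot deviation principle. The equilibrium condition at \<open>h\<close> compares actions through the
  eyes of vintage \<open>length h\<close>; consistency is what lets an earlier vintage \<open>s\<close> use that comparison.
\<close>

lemma pure_SPE_optimal:
  assumes tree: "is_event_tree E" and K: "kernel_system E K" and "0 \<le> \<beta>"
    and cons: "vintage_consistent E K"
    and \<pi>: "\<pi> \<in> pure_SPE E \<beta> K rw" and \<pi>': "\<pi>' \<in> policies E"
    and "h \<in> hists E" "s \<le> length h"
  shows "V E \<beta> K rw s \<pi>' h \<le> V E \<beta> K rw s \<pi> h"
  using assms(7,8)
proof (induction "horizon E - length h" arbitrary: h)
  case 0
  then show ?case by (simp add: V.simps)
next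
  case (Suc n)
  then have len: "length h < horizon E" by linarith
  then have h: "h \<in> decision_hists E" using Suc.prems by (simp add: decision_hists_def)
  then have a: "\<pi>' h \<in> acts E h" using \<pi>' by (auto simp: policies_def)
  have "Q E \<beta> K rw s \<pi>' h (\<pi>' h) \<le> Q E \<beta> K rw s \<pi> h (\<pi>' h)"
  proof (rule Q_mono[OF tree K \<open>0 \<le> \<beta>\<close> h a Suc.prems(2)])
    fix y assume "y \<in> obs E h (\<pi>' h)"
    then have "h @ [(\<pi>' h, y)] \<in> hists E"
      using Suc.prems(1) len a by (intro hists.step)
    then show "V E \<beta> K rw s \<pi>' (h @ [(\<pi>' h, y)]) \<le> V E \<beta> K rw s \<pi> (h @ [(\<pi>' h, y)])"
      using Suc.hyps(2) Suc.prems(2) by (intro Suc.hyps(1)) auto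
  qed
  also have "\<dots> = Q E \<beta> K rw (length h) \<pi> h (\<pi>' h)"
    using Q_vintage_independent[OF cons len Suc.prems(2)] by blast
  also have "\<dots> \<le> Q E \<beta> K rw (length h) \<pi> h (\<pi> h)"
    using \<pi> h a by (simp add: pure_SPE_def)
  also have "\<dots> = Q E \<beta> K rw s \<pi> h (\<pi> h)"
    using Q_vintage_independent[OF cons len _ Suc.prems(2)] by blast
  finally show ?case using len by (simp add: V.simps)
qed

lemma relearning_loss_consistent:
  assumes "is_event_tree E" "kernel_system E K" "0 \<le> \<beta>" "vintage_consistent E K"
    and \<pi>: "\<pi> \<in> pure_SPE E \<beta> K rw"
  shows "relearning_loss E \<beta> K rw \<pi> = 0"
proof -
  have "precommitment_value E \<beta> K rw = V E \<beta> K rw 0 \<pi> []"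
    unfolding precommitment_value_def
  proof (rule Max_eqI)
    show "finite ((\<lambda>\<pi>. V E \<beta> K rw 0 \<pi> []) ` policies E)"
      using finite_policies assms(1) by blast
    show "V E \<beta> K rw 0 \<pi> [] \<in> (\<lambda>\<pi>. V E \<beta> K rw 0 \<pi> []) ` policies E"
      using \<pi> by (simp add: pure_SPE_def)
  qed (use pure_SPE_optimal[OF assms] hists.root in auto)
  then show ?thesis by (simp add: relearning_loss_def)
qed

lemma V_zero_rewards:
  assumes K: "kernel_system E K" and \<pi>: "\<pi> \<in> policies E"
    and "h \<in> hists E" "s \<le> length h"
  shows "V E \<beta> K (\<lambda>_ _. 0, \<lambda>_. 0) s \<pi> h = 0"
  using assms(3,4)
proof (induction "horizon E - length h" arbitrary: h)
  case 0
  then show ?case by (simp add: V.simps)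
next
  case (Suc n)
  then have h: "h \<in> decision_hists E" by (auto simp: decision_hists_def)
  then have a: "\<pi> h \<in> acts E h" using \<pi> by (auto simp: policies_def)
  have "V E \<beta> K (\<lambda>_ _. 0, \<lambda>_. 0) s \<pi> (h @ [(\<pi> h, y)]) = 0" if "y \<in> obs E h (\<pi> h)" for y
    using Suc.hyps(2) Suc.prems a that
    by (intro Suc.hyps(1) hists.step) auto
  then show ?case
    using kernel_systemD(1)[OF K h a Suc.prems(2)] by (simp add: V.simps[of _ _ _ _ _ _ h] Q.simps)
qed

text \<open>
  This makes the supremum that defines the price range over a nonempty set: over the empty set it
  would be \<open>-\<infinity>\<close> instead of 0.
\<close>

lemma pure_SPE_zero_rewards:
  assumes K: "kernel_system E K"
  shows "pure_SPE E \<beta> K (\<lambda>_ _. 0, \<lambda>_. 0) = policies E"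
proof -
  have "Q E \<beta> K (\<lambda>_ _. 0, \<lambda>_. 0) (length h) \<pi> h a = 0"
    if \<pi>: "\<pi> \<in> policies E" and h: "h \<in> decision_hists E" "a \<in> acts E h" for \<pi> h a
  proof -
    have "V E \<beta> K (\<lambda>_ _. 0, \<lambda>_. 0) (length h) \<pi> (h @ [(a, y)]) = 0" if "y \<in> obs E h a" for y
      using h that
      by (intro V_zero_rewards[OF K \<pi>] hists.step) (auto simp: decision_hists_def)
    then show ?thesis
      using kernel_systemD(1)[OF K h order_refl] by (simp add: Q.simps)
  qed
  moreover have "\<pi> h \<in> acts E h" if "\<pi> \<in> policies E" "h \<in> decision_hists E" for \<pi> h
    using that by (auto simp: policies_def)
  ultimately show ?thesis by (auto simp: pure_SPE_def)
qed

lemma price_of_relearning_consistent: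
  assumes env: "environment E \<beta> R G" and K: "kernel_system E K"
    and cons: "vintage_consistent E K"
  shows "price_of_relearning E \<beta> R G K = 0"
proof -
  have loss: "relearning_loss E \<beta> K rw \<pi> = 0" if "\<pi> \<in> pure_SPE E \<beta> K rw" for rw \<pi>
    using relearning_loss_consistent[OF _ K _ cons that] env by (simp add: environment_def)
  have zero: "(\<lambda>_ _. 0, \<lambda>_. 0) \<in> reward_systems E R G"
    using env by (auto simp: environment_def reward_systems_def decision_hists_def)
  obtain \<pi> where \<pi>: "\<pi> \<in> pure_SPE E \<beta> K (\<lambda>_ _. 0, \<lambda>_. 0)"
    using policies_nonempty env unfolding pure_SPE_zero_rewards[OF K] environment_def by blast
  show ?thesis
    unfolding price_of_relearning_def
  proof (rule antisym)
    show "(SUP rw\<in>reward_systems E R G. SUP \<pi>\<in>pure_SPE E \<beta> K rw.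
        ereal (relearning_loss E \<beta> K rw \<pi>)) \<le> 0"
      by (intro SUP_least) (simp add: loss)
    show "0 \<le> (SUP rw\<in>reward_systems E R G. SUP \<pi>\<in>pure_SPE E \<beta> K rw.
        ereal (relearning_loss E \<beta> K rw \<pi>))"
      by (rule SUP_upper2[OF zero], rule SUP_upper2[OF \<pi>]) (simp add: loss[OF \<pi>])
  qed
qed

section \<open>Point forecasts\<close>

text \<open>
  In such a system vintage \<open>s\<close> is certain that the observation after date \<open>t\<close> will be \<open>f s t\<close>,
  whatever the history and the action.
\<close>

definition point_kernels ::
  "('a, 'y) event_tree \<Rightarrow> (nat \<Rightarrow> nat \<Rightarrow> 'y) \<Rightarrow> ('a, 'y) kernels" where
  "point_kernels E f s t h a =
     (if s \<le> t \<and> t < horizon E \<and> h \<in> hists E \<and> length h = t \<and> a \<in> acts E h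
      then {\<lambda>y. of_bool (y = f s t)} else {})"

lemma kernel_system_point_kernels:
  assumes "is_event_tree E"
    and "\<And>s h a. \<lbrakk>h \<in> decision_hists E; a \<in> acts E h; s \<le> length h\<rbrakk> \<Longrightarrow> f s (length h) \<in> obs E h a"
  shows "kernel_system E (point_kernels E f)"
proof -
  have "(\<lambda>y. of_bool (y = f s (length h))) \<in> prob_simplex (obs E h a)"
    if "h \<in> decision_hists E" "a \<in> acts E h" "s \<le> length h" for s h a
  proof -
    have "finite (obs E h a)" using assms(1) that by (auto simp: is_event_tree_def)
    then show ?thesis using assms(2)[OF that] by (auto simp: prob_simplex_def of_bool_def)
  qed
  then show ?thesis
    by (auto simp: kernel_system_def point_kernels_def decision_hists_def)
qed

lemma Q_point_kernels:
  assumes "is_event_tree E" "h \<in> decision_hists E" "a \<in> acts E h" "s \<le> length h"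
    and "f s (length h) \<in> obs E h a"
  shows "Q E \<beta> (point_kernels E f) rw s \<pi> h a =
    fst rw h a + \<beta> * V E \<beta> (point_kernels E f) rw s \<pi> (h @ [(a, f s (length h))])"
proof -
  have "finite (obs E h a)" using assms by (auto simp: is_event_tree_def)
  then show ?thesis
    using assms
    by (simp add: Q.simps point_kernels_def decision_hists_def of_bool_def
      if_distribR if_distrib[of "\<lambda>x. x * _"] cong: if_cong)
qed

lemma strict_action_gaps_imp_pure_SPE:
  assumes "\<pi> \<in> policies E" "strict_action_gaps E \<beta> K rw \<pi>"
  shows "\<pi> \<in> pure_SPE E \<beta> K rw"
  using assms unfolding pure_SPE_def strict_action_gaps_def mem_Collect_eq
  by (metis less_eq_real_def)

section \<open>A bet on the last observation\<close>

definition bet_tree :: "(nat, nat) event_tree" where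
  "bet_tree = \<lparr>horizon = 3,
     acts = \<lambda>h. if length h = 1 then {0, 1} else {0},
     obs = \<lambda>h a. if length h = 2 then {0, 1} else {0}\<rparr>"

definition bet_rewards :: "(nat, nat) rewards" where
  "bet_rewards = (\<lambda>_ _. 0, \<lambda>h. of_bool (fst (h ! 1) = snd (h ! 2)))"

definition detour_forecast :: "nat \<Rightarrow> nat \<Rightarrow> nat" where
  "detour_forecast s t = of_bool (s = 1 \<and> t = 2)"

abbreviation detour_kernels :: "(nat, nat) kernels" where
  "detour_kernels \<equiv> point_kernels bet_tree detour_forecast"

abbreviation steady_kernels :: "(nat, nat) kernels" where
  "steady_kernels \<equiv> point_kernels bet_tree (\<lambda>_ _. 0)"

lemma bet_tree_simps [simp]:
  "horizon bet_tree = 3"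
  "acts bet_tree h = (if length h = 1 then {0, 1} else {0})"
  "obs bet_tree h a = (if length h = 2 then {0, 1} else {0})"
  by (simp_all add: bet_tree_def)

lemma is_event_tree_bet_tree: "is_event_tree bet_tree"
  by (simp add: is_event_tree_def)

lemma bet_environment: "environment bet_tree 1 (\<lambda>_. 0) 1"
  by (simp add: environment_def is_event_tree_bet_tree)

lemma bet_decision_hists [simp]:
  "[] \<in> decision_hists bet_tree"
  "[(0, 0)] \<in> decision_hists bet_tree"
  "a \<le> 1 \<Longrightarrow> [(0, 0), (a, 0)] \<in> decision_hists bet_tree"
proof -
  show root: "[] \<in> decision_hists bet_tree"
    by (simp add: decision_hists_def hists.root)
  then show one: "[(0, 0)] \<in> decision_hists bet_tree"
    using snoc_in_hists_iff[of "[]" 0 0 bet_tree] by (simp add: decision_hists_def)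
  show "[(0, 0), (a, 0)] \<in> decision_hists bet_tree" if "a \<le> 1"
    using one that snoc_in_hists_iff[of "[(0, 0)]" a 0 bet_tree]
    by (auto simp: decision_hists_def)
qed

lemma bet_hist_date_1:
  assumes "h \<in> decision_hists bet_tree" "length h = 1"
  shows "h = [(0, 0)]"
proof -
  obtain a y where h: "h = [] @ [(a, y)]"
    using assms(2) by (cases h) auto
  have "h \<in> hists bet_tree" using assms(1) by (simp add: decision_hists_def)
  then show ?thesis unfolding h snoc_in_hists_iff by simp
qed

lemma bet_reward_system: "bet_rewards \<in> reward_systems bet_tree (\<lambda>_. 0) 1"
  by (auto simp: bet_rewards_def reward_systems_def)

lemma detour_kernel_system: "kernel_system bet_tree detour_kernels"
  by (rule kernel_system_point_kernels[OF is_event_tree_bet_tree])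
     (auto simp: detour_forecast_def)

lemma steady_kernel_system: "kernel_system bet_tree steady_kernels"
  by (rule kernel_system_point_kernels[OF is_event_tree_bet_tree]) auto

lemma price_of_relearning_steady: "price_of_relearning bet_tree 1 (\<lambda>_. 0) 1 steady_kernels = 0"
  by (rule price_of_relearning_consistent[OF bet_environment steady_kernel_system])
     (auto simp: vintage_consistent_def point_kernels_def fun_eq_iff)

text \<open>
  The vintages 0 and 2 never make the deviating forecast, and vintage 1 makes it only for
  date 2, which no endpoint pair shows.
\<close>

lemma endpoint_kernels_agree:
  "detour_kernels 0 u = steady_kernels 0 u" "detour_kernels u u = steady_kernels u u"
  by (auto simp: fun_eq_iff point_kernels_def detour_forecast_def)

lemma bet_policy_values:
  assumes "\<pi> \<in> policies bet_tree"
  shows "h \<in> decision_hists bet_tree \<Longrightarrow> length h \<noteq> 1 \<Longrightarrow> \<pi> h = 0"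
    and "\<pi> [(0, 0)] \<le> 1"
proof -
  have *: "\<pi> h \<in> acts bet_tree h" if "h \<in> decision_hists bet_tree" for h
    using assms that unfolding policies_def by blast
  show "\<pi> h = 0" if "h \<in> decision_hists bet_tree" "length h \<noteq> 1"
    using *[OF that(1)] that(2) by simp
  show "\<pi> [(0, 0)] \<le> 1" using *[of "[(0, 0)]"] by auto
qed

text \<open>
  A vintage \<open>s \<le> 1\<close> predicts that the last observation is \<open>s\<close> itself, so the bet \<open>a\<close> wins in its
  eyes exactly if \<open>a = s\<close>.
\<close>

lemma bet_value:
  assumes \<pi>: "\<pi> \<in> policies bet_tree" and "s \<le> 1" "a \<le> 1"
  shows "Q bet_tree 1 detour_kernels bet_rewards s \<pi> [(0, 0)] a = of_bool (a = s)"
proof -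
  let ?h = "[(0, 0), (a, 0)]"
  have h: "?h \<in> decision_hists bet_tree" using \<open>a \<le> 1\<close> by simp
  then have \<pi>h: "\<pi> ?h = 0" using bet_policy_values(1)[OF \<pi>] by simp
  have "Q bet_tree 1 detour_kernels bet_rewards s \<pi> [(0, 0)] a =
      V bet_tree 1 detour_kernels bet_rewards s \<pi> ?h"
    using assms by (subst Q_point_kernels[OF is_event_tree_bet_tree])
      (auto simp: bet_rewards_def detour_forecast_def)
  also have "\<dots> = Q bet_tree 1 detour_kernels bet_rewards s \<pi> ?h 0"
    by (simp add: V.simps \<pi>h)
  also have "\<dots> = V bet_tree 1 detour_kernels bet_rewards s \<pi> (?h @ [(0, s)])"
    using assms by (subst Q_point_kernels[OF is_event_tree_bet_tree h])
      (auto simp: bet_rewards_def detour_forecast_def le_Suc_eq)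
  also have "\<dots> = of_bool (a = s)"
    by (simp add: V.simps bet_rewards_def)
  finally show ?thesis .
qed

lemma bet_value_root:
  assumes \<pi>: "\<pi> \<in> policies bet_tree"
  shows "V bet_tree 1 detour_kernels bet_rewards 0 \<pi> [] = of_bool (\<pi> [(0, 0)] = 0)"
proof -
  have "V bet_tree 1 detour_kernels bet_rewards 0 \<pi> [] =
      Q bet_tree 1 detour_kernels bet_rewards 0 \<pi> [] 0"
    using bet_policy_values(1)[OF \<pi>, of "[]"] by (simp add: V.simps)
  also have "\<dots> = V bet_tree 1 detour_kernels bet_rewards 0 \<pi> [(0, 0)]"
    by (subst Q_point_kernels[OF is_event_tree_bet_tree])
      (auto simp: bet_rewards_def detour_forecast_def)
  also have "\<dots> = of_bool (\<pi> [(0, 0)] = 0)"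
    using bet_value[OF \<pi> _ bet_policy_values(2)[OF \<pi>], of 0] by (simp add: V.simps)
  finally show ?thesis .
qed

definition bet_policy :: "nat \<Rightarrow> (nat, nat) hist \<Rightarrow> nat" where
  "bet_policy b = restrict (\<lambda>h. if length h = 1 then b else 0) (decision_hists bet_tree)"

lemma bet_policy_in_policies: "b \<le> 1 \<Longrightarrow> bet_policy b \<in> policies bet_tree"
  by (auto simp: bet_policy_def policies_def le_Suc_eq)

lemma bet_policy_date_1 [simp]: "bet_policy b [(0, 0)] = b"
  by (simp add: bet_policy_def)

text \<open>The bet at date 1 is the only choice that a policy makes.\<close>

lemma policy_eq_bet_policy:
  assumes "\<pi> \<in> policies bet_tree"
  shows "\<pi> = bet_policy (\<pi> [(0, 0)])"
proof (rule ext)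
  fix h
  show "\<pi> h = bet_policy (\<pi> [(0, 0)]) h"
  proof (cases "h \<in> decision_hists bet_tree")
    case True
    then show ?thesis
      using bet_policy_values(1)[OF assms True] bet_hist_date_1[OF True]
      by (auto simp: bet_policy_def)
  next
    case False
    then show ?thesis
      using assms by (auto simp: bet_policy_def policies_def PiE_def extensional_def)
  qed
qed

lemma bet_strict_action_gaps:
  "strict_action_gaps bet_tree 1 detour_kernels bet_rewards (bet_policy 1)"
  unfolding strict_action_gaps_def
proof (intro ballI impI)
  fix h a
  assume h: "h \<in> decision_hists bet_tree" and a: "a \<in> acts bet_tree h" "a \<noteq> bet_policy 1 h"
  have "length h = 1"
    using a bet_policy_values(1)[OF bet_policy_in_policies h, of 1] by (auto split: if_splits)
  then have h1: "h = [(0, 0)]" by (rule bet_hist_date_1[OF h])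
  then have "a = 0" using a by auto
  then show "Q bet_tree 1 detour_kernels bet_rewards (length h) (bet_policy 1) h a
      < Q bet_tree 1 detour_kernels bet_rewards (length h) (bet_policy 1) h (bet_policy 1 h)"
    using bet_value[OF bet_policy_in_policies, of 1 1] by (simp add: h1)
qed

lemma bet_unique_SPE: "pure_SPE bet_tree 1 detour_kernels bet_rewards = {bet_policy 1}"
proof (rule antisym)
  show "{bet_policy 1} \<subseteq> pure_SPE bet_tree 1 detour_kernels bet_rewards"
    using strict_action_gaps_imp_pure_SPE[OF bet_policy_in_policies bet_strict_action_gaps]
    by simp
  show "pure_SPE bet_tree 1 detour_kernels bet_rewards \<subseteq> {bet_policy 1}"
  proof
    fix \<pi> assume SPE: "\<pi> \<in> pure_SPE bet_tree 1 detour_kernels bet_rewards"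
    then have \<pi>: "\<pi> \<in> policies bet_tree" by (simp add: pure_SPE_def)
    have "Q bet_tree 1 detour_kernels bet_rewards 1 \<pi> [(0, 0)] 1
        \<le> Q bet_tree 1 detour_kernels bet_rewards 1 \<pi> [(0, 0)] (\<pi> [(0, 0)])"
    proof -
      have "\<forall>a\<in>acts bet_tree [(0, 0)].
          Q bet_tree 1 detour_kernels bet_rewards (length [(0 :: nat, 0 :: nat)]) \<pi> [(0, 0)] a
          \<le> Q bet_tree 1 detour_kernels bet_rewards (length [(0 :: nat, 0 :: nat)]) \<pi> [(0, 0)]
              (\<pi> [(0, 0)])"
        using SPE bet_decision_hists(2) unfolding pure_SPE_def by blast
      then show ?thesis by simp
    qed
    then have "\<pi> [(0, 0)] = 1"
      using bet_value[OF \<pi> order_refl] bet_policy_values(2)[OF \<pi>]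
      by (auto simp: of_bool_def split: if_splits)
    then show "\<pi> \<in> {bet_policy 1}" using policy_eq_bet_policy[OF \<pi>] by simp
  qed
qed

lemma bet_relearning_loss:
  "relearning_loss bet_tree 1 detour_kernels bet_rewards (bet_policy 1) = 1"
proof -
  have "precommitment_value bet_tree 1 detour_kernels bet_rewards = 1"
    unfolding precommitment_value_def
  proof (rule Max_eqI)
    show "finite ((\<lambda>\<pi>. V bet_tree 1 detour_kernels bet_rewards 0 \<pi> []) ` policies bet_tree)"
      using finite_policies[OF is_event_tree_bet_tree] by blast
    show "1 \<in> (\<lambda>\<pi>. V bet_tree 1 detour_kernels bet_rewards 0 \<pi> []) ` policies bet_tree"
      using bet_policy_in_policies[of 0] bet_value_root[of "bet_policy 0"]
      by (intro image_eqI[of _ _ "bet_policy 0"]) simp_all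
  qed (auto simp: bet_value_root)
  then show ?thesis
    using bet_value_root[OF bet_policy_in_policies[of 1]] by (simp add: relearning_loss_def)
qed

lemma price_of_relearning_detour:
  "price_of_relearning bet_tree 1 (\<lambda>_. 0) 1 detour_kernels > 0"
proof -
  have "ereal 1 \<le> price_of_relearning bet_tree 1 (\<lambda>_. 0) 1 detour_kernels"
    unfolding price_of_relearning_def
    by (rule SUP_upper2[OF bet_reward_system]) (simp add: bet_unique_SPE bet_relearning_loss del: One_nat_def)
  then show ?thesis using order.strict_trans2[of 0 "ereal 1"] by simp
qed

section \<open>Endpoint pairs do not determine the price\<close>

theorem proposition7p3:
  shows "(\<exists>(E :: (nat, nat) event_tree) \<beta> R G K K'.
            environment E \<beta> R G \<and> horizon E = 3 \<and>
            kernel_system E K \<and> kernel_system E K' \<and>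
            (\<forall>u<3. K 0 u = K' 0 u \<and> K u u = K' u u) \<and>
            price_of_relearning E \<beta> R G K > 0 \<and>
            price_of_relearning E \<beta> R G K' = 0 \<and>
            (\<exists>rw\<in>reward_systems E R G. \<exists>\<pi>.
               pure_SPE E \<beta> K rw = {\<pi>} \<and>
               strict_action_gaps E \<beta> K rw \<pi> \<and>
               relearning_loss E \<beta> K rw \<pi> > 0))
       \<and> \<not> (\<exists>F. \<forall>(E :: (nat, nat) event_tree) \<beta> R G K.
              environment E \<beta> R G \<longrightarrow> kernel_system E K \<longrightarrow>
              price_of_relearning E \<beta> R G K = F E \<beta> R G (endpoint_pairs K))"
proof (intro conjI)
  show "\<exists>(E :: (nat, nat) event_tree) \<beta> R G K K'.
            environment E \<beta> R G \<and> horizon E = 3 \<and>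
            kernel_system E K \<and> kernel_system E K' \<and>
            (\<forall>u<3. K 0 u = K' 0 u \<and> K u u = K' u u) \<and>
            price_of_relearning E \<beta> R G K > 0 \<and>
            price_of_relearning E \<beta> R G K' = 0 \<and>
            (\<exists>rw\<in>reward_systems E R G. \<exists>\<pi>.
               pure_SPE E \<beta> K rw = {\<pi>} \<and>
               strict_action_gaps E \<beta> K rw \<pi> \<and>
               relearning_loss E \<beta> K rw \<pi> > 0)"
  proof (intro exI conjI)
    show "environment bet_tree 1 (\<lambda>_. 0) 1" by (rule bet_environment)
    show "\<exists>rw\<in>reward_systems bet_tree (\<lambda>_. 0) 1. \<exists>\<pi>.
        pure_SPE bet_tree 1 detour_kernels rw = {\<pi>} \<and>
        strict_action_gaps bet_tree 1 detour_kernels rw \<pi> \<and>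
        relearning_loss bet_tree 1 detour_kernels rw \<pi> > 0"
      using bet_reward_system bet_unique_SPE bet_strict_action_gaps
      by (intro bexI[of _ bet_rewards] exI[of _ "bet_policy 1"])
         (simp_all add: bet_relearning_loss del: One_nat_def)
    show "kernel_system bet_tree steady_kernels" by (rule steady_kernel_system)
  qed (use detour_kernel_system endpoint_kernels_agree price_of_relearning_detour
        price_of_relearning_steady in auto)
  show "\<not> (\<exists>F. \<forall>(E :: (nat, nat) event_tree) \<beta> R G K.
              environment E \<beta> R G \<longrightarrow> kernel_system E K \<longrightarrow>
              price_of_relearning E \<beta> R G K = F E \<beta> R G (endpoint_pairs K))"
  proof
    assume "\<exists>F. \<forall>(E :: (nat, nat) event_tree) \<beta> R G K.
              environment E \<beta> R G \<longrightarrow> kernel_system E K \<longrightarrow>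
              price_of_relearning E \<beta> R G K = F E \<beta> R G (endpoint_pairs K)"
    then obtain F where F: "\<And>(E :: (nat, nat) event_tree) \<beta> R G K.
        environment E \<beta> R G \<Longrightarrow> kernel_system E K \<Longrightarrow>
        price_of_relearning E \<beta> R G K = F E \<beta> R G (endpoint_pairs K)"
      by blast
    have "endpoint_pairs detour_kernels = endpoint_pairs steady_kernels"
      by (simp add: endpoint_pairs_def endpoint_kernels_agree)
    then have "price_of_relearning bet_tree 1 (\<lambda>_. 0) 1 detour_kernels
        = price_of_relearning bet_tree 1 (\<lambda>_. 0) 1 steady_kernels"
      using F[OF bet_environment detour_kernel_system] F[OF bet_environment steady_kernel_system]
      by simp
    then show False
      using price_of_relearning_detour price_of_relearning_steady by simp
  qed
qed

end
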